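(* There exists $M\in\mathbb{N}$ such that for all $m,n\in\mathbb{N}$ with $m\ge M$ and $n\ge\lceil 1.1\log(2.5m)\rceil$, $$\pi(mn)-\pi(n)\ge m-1.$$
   Context: $\mathbb{N}$ is the set of positive integers, $\pi(x)$ is the number of primes $\le x$, and $\log$ is the natural logarithm. *)

theory Defs
  imports Complex_Main "HOL-Computational_Algebra.Primes"
begin

definition prime_pi :: "real \<Rightarrow> nat" where
  "prime_pi x = card {p :: nat. prime p \<and> real p \<le> x}"

end

theory Submission
  imports Defs "HOL-Number_Theory.Prime_Powers" "HOL-Real_Asymp.Real_Asymp"
begin

text \<open>
  Since $n$ is at least $1.1 \log m$, the quotient $mn / \log (mn)$ is at least about $1.1\,m$.
  A lower bound of Chebyshev type, $\pi(x) \ge c\,x / \log x$ with a constant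
  $c > 10/11 = 0.909\ldots$, therefore produces more than $m$ primes up to $mn$, with a positive
  proportion to spare. The central binomial coefficient only yields $c = \log 2 = 0.69\ldots$;
  Chebyshev's quotient $(30k)!\,k! / ((15k)!\,(10k)!\,(6k)!)$ yields $c = 0.921\ldots$, of which
  the rounded value $11/12$ is enough (lemmas \<open>ln_chebyshev_quotient_le_psi\<close> and
  \<open>psi_lower\<close>).

  The primes up to $n$ have to be discarded, and $n$ may be arbitrarily large compared with $m$, so
  the trivial bound $\pi(n) \le n$ does not suffice. The whole argument is thus run with
  $\psi(mn) - \psi(n)$, the sum of the von Mangoldt function over $(n, mn]$: here the bound
  $\psi(n) \le 4n$ (lemma \<open>psi_upper\<close>) costs only the fraction $4/m$ of $mn$, uniformly
  in $n$. Proper prime powers contribute $O(\sqrt{mn} \log^2 (mn))$, and each prime in $(n, mn]$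
  contributes at most $\log (mn)$ (lemma \<open>psi_diff_le_prime_pi_diff\<close>). Dividing by
  $\log (mn)$ gives the count of primes.
\<close>

section \<open>Chebyshev's function and factorials\<close>

definition psi :: "nat \<Rightarrow> real" where
  "psi n = (\<Sum>d=1..n. mangoldt d)"

lemma psi_mono: "m \<le> n \<Longrightarrow> psi m \<le> psi n"
  unfolding psi_def by (intro sum_mono2) (auto simp: mangoldt_nonneg)

text \<open>
  The logarithm of each $k \le n$ is the sum of $\Lambda$ over the divisors of $k$, and $d$ divides
  exactly \<open>n div d\<close> of these $k$. The range of summation may extend beyond $n$, where the quotients
  vanish; this puts the logarithms of several factorials over a common range.
\<close>

lemma ln_fact_conv_mangoldt:
  assumes "n \<le> N"
  shows "ln (fact n) = (\<Sum>d=1..N. mangoldt d * real (n div d))"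
  using assms
proof (induction n)
  case 0
  show ?case by simp
next
  case (Suc n)
  have "{d. d dvd Suc n} \<subseteq> {1..N}"
  proof
    fix d assume "d \<in> {d. d dvd Suc n}"
    hence "d dvd Suc n" by simp
    hence "d \<le> Suc n" "d > 0" by (simp_all add: dvd_imp_le dvd_pos_nat[of "Suc n"])
    thus "d \<in> {1..N}" using Suc.prems by simp
  qed
  hence "(\<Sum>d | d dvd Suc n. mangoldt d) = (\<Sum>d\<in>{1..N}. if d dvd Suc n then mangoldt d else (0::real))"
    by (intro sum.mono_neutral_cong_left) auto
  moreover have "ln (real (Suc n)) = (\<Sum>d | d dvd Suc n. mangoldt d)"
    using mangoldt_sum[of "Suc n", where ?'a = real] by simp
  ultimately have "ln (fact (Suc n)) = (\<Sum>d=1..N. mangoldt d * real (n div d))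
                   + (\<Sum>d\<in>{1..N}. if d dvd Suc n then mangoldt d else 0)"
    using Suc by (simp add: ln_mult del: of_nat_Suc)
  also have "\<dots> = (\<Sum>d=1..N. mangoldt d * real (Suc n div d))"
    by (subst sum.distrib [symmetric], intro sum.cong refl)
       (auto simp: div_Suc dvd_eq_mod_eq_0 algebra_simps)
  finally show ?case .
qed

text \<open>
  A crude form of Stirling's formula. Only the term of order $\log n$ is lost, which leaves the
  leading constant in Chebyshev's estimate untouched.
\<close>

lemma ln_fact_bounds:
  assumes "n \<ge> 1"
  shows "real n * ln n - n \<le> ln (fact n)"
    and "ln (fact n) \<le> real n * ln n - n + ln n + 1"
proof -
  have "real n * ln n - n \<le> ln (fact n) \<and> ln (fact n) \<le> real n * ln n - n + ln n + 1"
    using assms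
  proof (induction n rule: dec_induct)
    case base
    show ?case by simp
  next
    case (step n)
    define x where "x = real n"
    have x: "x \<ge> 1" using step by (simp add: x_def)
    define t where "t = ln (x + 1) - ln x"
    have "t = ln ((x + 1) / x)" using x unfolding t_def by (subst ln_div) auto
    also have "\<dots> = ln (1 + 1 / x)" using x by (simp add: add_divide_distrib)
    also have "\<dots> \<le> 1 / x" using x by (intro ln_add_one_self_le_self) auto
    finally have t1: "x * t \<le> 1" using x by (simp add: field_simps)
    have "- t = ln (x / (x + 1))"
      using x unfolding t_def by (subst ln_div) auto
    also have "\<dots> \<le> x / (x + 1) - 1" using x by (intro ln_le_minus_one) auto
    finally have t2: "(x + 1) * t \<ge> 1" using x by (simp add: field_simps)
    have S: "ln (fact (Suc n)) = ln (fact n) + ln (x + 1)"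
      by (simp add: ln_mult x_def add.commute del: of_nat_Suc flip: of_nat_Suc)
    have l: "ln (x + 1) = ln x + t" by (simp add: t_def)
    show ?case
      using step.IH t1 t2 unfolding S of_nat_Suc x_def[symmetric] add.commute[of 1 x] l
      by (simp add: algebra_simps)
  qed
  thus "real n * ln n - n \<le> ln (fact n)"
    and "ln (fact n) \<le> real n * ln n - n + ln n + 1" by auto
qed

section \<open>Chebyshev's lower bound\<close>

text \<open>
  Because $1 + 1/30 = 1/2 + 1/3 + 1/5$, the fractional parts alone remain, and the difference is at most
  $1/2 + 2/3 + 4/5 = 59/30 < 2$. An integer below $2$ is at most $1$.
\<close>

lemma chebyshev_digits: "T + T div 30 \<le> T div 2 + T div 3 + T div 5 + (1::nat)"
  by linarith

text \<open>
  In the expansion of the left-hand side, the coefficient of $\Lambda(d)$ depends only on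
  \<open>T = 30 * k div d\<close>, as all the other quotients are obtained from $T$ by a further division;
  it is at most $1$ by the previous lemma.
\<close>

lemma ln_chebyshev_quotient_le_psi:
  "ln (fact (30 * k)) + ln (fact k)
     - ln (fact (15 * k)) - ln (fact (10 * k)) - ln (fact (6 * k)) \<le> psi (30 * k)"
proof -
  define c where "c T = real T + real (T div 30) - real (T div 2) - real (T div 3) - real (T div 5)"
    for T :: nat
  have c_le: "c T \<le> 1" for T
    using chebyshev_digits[of T] unfolding c_def by linarith
  have nested: "j * k div d = 30 * k div d div i" if "i * j = 30" for i j d
  proof -
    have "30 * k div d div i = i * (j * k) div (i * d)"
      by (simp only: div_mult2_eq [symmetric] mult.assoc [symmetric] that mult.commute[of d i])
    also have "\<dots> = j * k div d" using that by (intro div_mult_mult1) (cases i; simp)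
    finally show ?thesis ..
  qed
  have "ln (fact (30 * k)) + ln (fact k)
     - ln (fact (15 * k)) - ln (fact (10 * k)) - ln (fact (6 * k))
     = (\<Sum>d=1..30*k. mangoldt d * (real (30 * k div d) + real (k div d)
          - real (15 * k div d) - real (10 * k div d) - real (6 * k div d)))"
    by (simp add: ln_fact_conv_mangoldt[where N = "30 * k"] algebra_simps
          sum.distrib sum_subtractf)
  also have "\<dots> = (\<Sum>d=1..30*k. mangoldt d * c (30 * k div d))"
  proof (intro sum.cong refl)
    fix d
    show "mangoldt d * (real (30 * k div d) + real (k div d)
          - real (15 * k div d) - real (10 * k div d) - real (6 * k div d))
        = mangoldt d * c (30 * k div d)"
      using nested[of 30 1 d] nested[of 2 15 d] nested[of 3 10 d] nested[of 5 6 d]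
      unfolding c_def by simp
  qed
  also have "\<dots> \<le> psi (30 * k)"
    unfolding psi_def using c_le mangoldt_nonneg
    by (intro sum_mono mult_left_le) auto
  finally show ?thesis .
qed

text \<open>
  The left-hand side is the logarithm of $30^{30} / (15^{15} 10^{10} 6^6) = 2^{14} 3^9 5^5$, the
  exponential growth rate of Chebyshev's quotient; its value is $27.638\ldots$.
\<close>

lemma chebyshev_constant: "14 * ln 2 + 9 * ln 3 + 5 * ln 5 \<ge> (55 / 2 :: real)"
proof -
  \<comment> \<open>An upper bound for \<open>exp 1\<close> whose 55th power is below the square of $2^{14} 3^9 5^5$ has to be
      less than $2.732$. From \<open>exp (- (1 / N)) \<ge> 1 - 1 / N\<close> with $N = 128$ one gets $2.7290$.\<close>
  have "(127 / 128 :: real) \<le> exp (- (1 / 128))"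
    using exp_ge_add_one_self[of "- (1 / 128) :: real"] by simp
  hence "(127 / 128 :: real) ^ 128 \<le> exp (- (1 / 128)) ^ 128"
    by (intro power_mono) auto
  also have "\<dots> = exp (- 1)" by (simp flip: exp_of_nat_mult)
  also have "\<dots> = 1 / exp (1::real)" by (simp add: exp_minus divide_inverse)
  finally have "exp (1::real) \<le> 1 / (127 / 128) ^ 128" by (simp add: field_simps)
  also have "\<dots> \<le> 273 / 100" by (simp add: field_simps)
  finally have e: "exp (1::real) \<le> 273 / 100" .
  have "exp (55::real) = exp 1 ^ 55" by (simp flip: exp_of_nat_mult)
  also have "\<dots> \<le> (273 / 100) ^ 55" using e by (intro power_mono) auto
  also have "\<dots> \<le> 2 ^ 28 * 3 ^ 18 * 5 ^ 10" by (simp add: field_simps)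
  finally have "55 \<le> ln (2 ^ 28 * 3 ^ 18 * 5 ^ 10 :: real)"
    by (subst ln_ge_iff) auto
  also have "\<dots> = ln ((2::real) ^ 28) + ln ((3::real) ^ 18) + ln ((5::real) ^ 10)"
    using ln_mult[of "2 ^ 28 * 3 ^ 18 :: real" "5 ^ 10"] ln_mult[of "2 ^ 28 :: real" "3 ^ 18"]
    by simp
  also have "\<dots> = 28 * ln 2 + 18 * ln 3 + 10 * ln 5"
    by (simp only: ln_realpow of_nat_numeral)
  finally show ?thesis by simp
qed

text \<open>
  This is the estimate for Chebyshev's quotient with \<open>k = x div 30\<close>. The constant $31$ absorbs
  the rounding loss $\frac{11}{12} \cdot 29$ and the three units from the upper bounds on factorials.
\<close>

lemma psi_lower:
  assumes "x \<ge> 30"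
  shows "psi x \<ge> 11 / 12 * real x - 3 * ln x - 31"
proof -
  define k where "k = x div 30"
  have k: "k \<ge> 1" "30 * k \<le> x" "x \<le> 30 * k + 29" using assms unfolding k_def by auto
  define K where "K = real k"
  have K: "K \<ge> 1" "30 * K \<le> real x" "real x \<le> 30 * K + 29"
    using k unfolding K_def by linarith+
  define a where "a = ln K"
  define p q r where "p = ln (2::real)" and "q = ln (3::real)" and "r = ln (5::real)"
  have l6: "ln (6 * K) = p + q + a"
    using K ln_mult[of 2 "3 * K"] ln_mult[of 3 K] by (simp add: p_def q_def a_def)
  have l10: "ln (10 * K) = p + r + a"
    using K ln_mult[of 2 "5 * K"] ln_mult[of 5 K] by (simp add: p_def r_def a_def)
  have l15: "ln (15 * K) = q + r + a"
    using K ln_mult[of 3 "5 * K"] ln_mult[of 5 K] by (simp add: q_def r_def a_def)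
  have l30: "ln (30 * K) = p + q + r + a"
    using K ln_mult[of 2 "15 * K"] l15 by (simp add: p_def)
  have le: "ln (15 * K) \<le> ln x" "ln (10 * K) \<le> ln x" "ln (6 * K) \<le> ln x"
    using K by simp_all
  have "psi x \<ge> psi (30 * k)" using k by (intro psi_mono)
  moreover have "30 * K * ln (30 * K) - 30 * K \<le> ln (fact (30 * k))"
    using ln_fact_bounds(1)[of "30 * k"] k by (simp add: K_def)
  moreover have "K * a - K \<le> ln (fact k)"
    using ln_fact_bounds(1)[of k] k by (simp add: K_def a_def)
  moreover have "ln (fact (15 * k)) \<le> 15 * K * ln (15 * K) - 15 * K + ln x + 1"
    using ln_fact_bounds(2)[of "15 * k"] k le[unfolded K_def]
    by (simp add: K_def del: ln_le_cancel_iff)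
  moreover have "ln (fact (10 * k)) \<le> 10 * K * ln (10 * K) - 10 * K + ln x + 1"
    using ln_fact_bounds(2)[of "10 * k"] k le[unfolded K_def]
    by (simp add: K_def del: ln_le_cancel_iff)
  moreover have "ln (fact (6 * k)) \<le> 6 * K * ln (6 * K) - 6 * K + ln x + 1"
    using ln_fact_bounds(2)[of "6 * k"] k le[unfolded K_def]
    by (simp add: K_def del: ln_le_cancel_iff)
  moreover note ln_chebyshev_quotient_le_psi[of k]
  ultimately have "psi x \<ge> K * (14 * p + 9 * q + 5 * r) - 3 * ln x - 3"
    unfolding l30 l15 l10 l6 by (simp add: algebra_simps)
  moreover have "K * (14 * p + 9 * q + 5 * r) \<ge> K * (55 / 2)"
    using K chebyshev_constant by (intro mult_left_mono) (auto simp: p_def q_def r_def)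
  ultimately show ?thesis using K by linarith
qed

section \<open>An upper bound for Chebyshev's function\<close>

text \<open>
  Let $h$ be the rounded half of $n$. In the expansion of $\log (n! / h!^2)$ all coefficients of
  $\Lambda$ are nonnegative, and for $h < d \le n$ they are at least $1$, so the logarithm bounds
  $\psi(n) - \psi(h)$. The quotient is at most $4^n$ and $\log 4 \le 2$, so halving repeatedly gives
  the geometric series $2n + n + \cdots = 4n$.
\<close>

lemma psi_upper: "psi n \<le> 4 * real n"
proof (induction n rule: less_induct)
  case (less n)
  show ?case
  proof (cases "n = 0")
    case True
    thus ?thesis by (simp add: psi_def)
  next
    case False
    define h where "h = n div 2"
    have h: "h < n" "h \<le> n - h" "n - h \<le> Suc h" using False unfolding h_def by auto
    have "psi n - psi h = (\<Sum>d\<in>{h<..n}. mangoldt d)"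
    proof -
      have "{1..n} = {1..h} \<union> {h<..n}" using h by auto
      thus ?thesis unfolding psi_def by (simp add: sum.union_disjoint ivl_disj_int)
    qed
    also have "\<dots> \<le> (\<Sum>d\<in>{h<..n}. mangoldt d * (real (n div d) - 2 * real (h div d)))"
    proof (intro sum_mono)
      fix d assume d: "d \<in> {h<..n}"
      hence "n div d \<ge> 1" "h div d = 0" by (auto simp: div_greater_zero_iff Suc_le_eq)
      thus "mangoldt d \<le> mangoldt d * (real (n div d) - 2 * real (h div d))"
        using mangoldt_nonneg[of d] by (simp add: mult_le_cancel_left1)
    qed
    also have "\<dots> \<le> (\<Sum>d=1..n. mangoldt d * (real (n div d) - 2 * real (h div d)))"
    proof (intro sum_mono2)
      fix d
      have "h div d = n div d div 2" unfolding h_def by (metis div_mult2_eq mult.commute)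
      thus "0 \<le> mangoldt d * (real (n div d) - 2 * real (h div d))"
        using mangoldt_nonneg[of d] by (intro mult_nonneg_nonneg) linarith+
    qed auto
    also have "\<dots> = ln (fact n) - 2 * ln (fact h)"
      using h by (simp add: ln_fact_conv_mangoldt[where N = n] algebra_simps sum_subtractf
                    sum_distrib_left)
    also have "\<dots> \<le> real n * ln 4"
    proof -
      \<comment> \<open>For odd \<open>n\<close> the quotient exceeds the binomial coefficient by the factor \<open>Suc h\<close>.\<close>
      have "(fact n :: nat) = (n choose h) * fact h * fact (n - h)"
        using binomial_fact_lemma[of h n] h by (simp add: mult_ac)
      also have "\<dots> \<le> 2 ^ n * fact h * fact (Suc h)"
        using h by (intro mult_mono binomial_le_pow2 fact_mono) auto
      also have "\<dots> = 2 ^ n * Suc h * (fact h)\<^sup>2" by (simp add: power2_eq_square algebra_simps)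
      also have "\<dots> \<le> 2 ^ n * 2 ^ n * (fact h)\<^sup>2"
      proof (intro mult_mono)
        show "Suc h \<le> 2 ^ n" using h less_exp[of n] by linarith
      qed auto
      also have "\<dots> = 4 ^ n * (fact h)\<^sup>2" by (simp flip: power_mult_distrib)
      finally have "real (fact n) \<le> real (4 ^ n * (fact h)\<^sup>2)" by (rule of_nat_mono)
      hence "ln (real (fact n)) \<le> ln (real (4 ^ n * (fact h)\<^sup>2))" by (subst ln_le_cancel_iff) auto
      thus ?thesis by (simp add: ln_mult ln_realpow)
    qed
    also have "\<dots> \<le> real n * 2"
    proof -
      have "ln (4::real) = 2 * ln 2" using ln_realpow[of 2 2] by simp
      also have "\<dots> \<le> 2" using ln_le_minus_one[of 2] by simp
      finally show ?thesis by (intro mult_left_mono) auto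
    qed
    finally have "psi n \<le> psi h + 2 * real n" by simp
    also have "psi h \<le> 4 * real h" using less.IH h by simp
    also have "real h \<le> real n / 2" unfolding h_def by linarith
    finally show ?thesis by simp
  qed
qed

section \<open>From prime powers to primes\<close>

text \<open>
  A proper prime power $p^k \le x$ with $k \ge 2$ has $p \le \sqrt x$ and $k \le \log_2 x$.
\<close>

lemma card_nonprime_primepows:
  fixes x :: nat
  assumes "x \<ge> 1"
  shows "real (card {d \<in> {1..x}. primepow d \<and> \<not> prime d}) \<le> sqrt x * log 2 x"
proof -
  let ?A = "{d \<in> {1..x}. primepow d \<and> \<not> prime d}"
  define s l where "s = nat \<lfloor>sqrt x\<rfloor>" and "l = nat \<lfloor>log 2 x\<rfloor>"
  have "?A \<subseteq> (\<lambda>(p, k). p ^ k) ` ({1..s} \<times> {1..l})"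
  proof
    fix d assume d: "d \<in> ?A"
    then obtain p k where pk: "prime p" "k > 0" "d = p ^ k" by (auto simp: primepow_def)
    have "k \<ge> 2" using pk d by (cases "k = 1") auto
    have p: "p \<ge> 2" using pk(1) by (rule prime_ge_2_nat)
    have "p\<^sup>2 \<le> p ^ k" using p \<open>k \<ge> 2\<close> by (intro power_increasing) auto
    also have "\<dots> \<le> x" using d pk by auto
    finally have "real (p\<^sup>2) \<le> real x" by (rule of_nat_mono)
    hence "real p \<le> sqrt x" by (intro real_le_rsqrt) simp
    hence ps: "p \<le> s" unfolding s_def by linarith
    have "2 ^ k \<le> p ^ k" using p by (intro power_mono) auto
    also have "\<dots> \<le> x" using d pk by auto
    finally have "real (2 ^ k) \<le> real x" by (rule of_nat_mono)
    hence "real k \<le> log 2 x" using assms by (intro le_log_of_power) auto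
    hence kl: "k \<le> l" unfolding l_def by linarith
    show "d \<in> (\<lambda>(p, k). p ^ k) ` ({1..s} \<times> {1..l})"
      using pk p ps kl by (intro image_eqI[of _ _ "(p, k)"]) auto
  qed
  hence "card ?A \<le> card ({1..s} \<times> {1..l})" by (intro surj_card_le) auto
  hence "real (card ?A) \<le> real s * real l" by (simp flip: of_nat_mult)
  also have "\<dots> \<le> sqrt x * log 2 x"
    using assms unfolding s_def l_def by (intro mult_mono) auto
  finally show ?thesis .
qed

lemma prime_pi_diff:
  fixes n x :: nat
  assumes "n \<le> x"
  shows "real (prime_pi x) - real (prime_pi n) = card {p \<in> {n<..x}. prime p}"
proof -
  have *: "prime_pi (real y) = card {p \<in> {..y}. prime p}" for y
    unfolding prime_pi_def by (rule arg_cong[where f = card]) auto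
  have "{p \<in> {..x}. prime p} = {p \<in> {..n}. prime p} \<union> {p \<in> {n<..x}. prime p}"
    using assms by auto
  hence "card {p \<in> {..x}. prime p} = card {p \<in> {..n}. prime p} + card {p \<in> {n<..x}. prime p}"
    by (simp only:, intro card_Un_disjoint) auto
  thus ?thesis unfolding * by simp
qed

text \<open>
  Every prime power in $(n, x]$ has weight at most $\log x$. All proper prime powers up to $x$ are
  counted, including those up to $n$: even so their contribution is of lower order than $x$.
\<close>

lemma psi_diff_le_prime_pi_diff:
  fixes n x :: nat
  assumes "n \<le> x" "x \<ge> 1"
  shows "psi x - psi n \<le> (real (prime_pi x) - real (prime_pi n) + sqrt x * log 2 x) * ln x"
proof -
  let ?P = "{p \<in> {n<..x}. prime p}" and ?Q = "{d \<in> {1..x}. primepow d \<and> \<not> prime d}"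
  have "{1..x} = {1..n} \<union> {n<..x}" using assms by auto
  hence "psi x - psi n = (\<Sum>d\<in>{n<..x}. mangoldt d)"
    unfolding psi_def by (simp add: sum.union_disjoint ivl_disj_int)
  also have "\<dots> = (\<Sum>d\<in>{d \<in> {n<..x}. primepow d}. mangoldt d)"
    by (intro sum.mono_neutral_right) (auto simp: mangoldt_def)
  also have "\<dots> \<le> (\<Sum>d\<in>?P \<union> ?Q. mangoldt d)"
    by (intro sum_mono2) (auto simp: mangoldt_nonneg)
  also have "\<dots> \<le> (\<Sum>d\<in>?P \<union> ?Q. ln x)"
  proof (intro sum_mono)
    fix d assume "d \<in> ?P \<union> ?Q"
    hence d: "0 < d" "d \<le> x" by auto
    have "mangoldt d \<le> ln (real d)" using d by (intro mangoldt_le) auto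
    also have "\<dots> \<le> ln x" using d by simp
    finally show "mangoldt d \<le> ln (real x)" .
  qed
  also have "\<dots> = real (card ?P + card ?Q) * ln x"
    by (subst card_Un_disjoint [symmetric]) auto
  also have "\<dots> \<le> (card ?P + sqrt x * log 2 x) * ln x"
    using assms card_nonprime_primepows[OF assms(2)] by (intro mult_right_mono) simp_all
  finally show ?thesis using prime_pi_diff[OF assms(1)] by simp
qed

section \<open>Primes between $n$ and $mn$\<close>

theorem theoremG:
  shows "\<exists>M::nat. M \<ge> 1 \<and>
    (\<forall>m n :: nat. m \<ge> 1 \<longrightarrow> n \<ge> 1 \<longrightarrow> m \<ge> M \<longrightarrow>
       int n \<ge> \<lceil>(1.1::real) * ln (2.5 * real m)\<rceil> \<longrightarrow>
       int (prime_pi (real (m * n))) - int (prime_pi (real n)) \<ge> int m - 1)"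
proof -
  \<comment> \<open>The constant $183/200 = 0.915$ lies below $11/12 = 0.9166\ldots$, which absorbs all errors of
      lower order in $x = mn$, and still exceeds $10/11$.\<close>
  have "\<forall>\<^sub>F x::real in at_top.
      183 / 200 * x + sqrt x * log 2 x * ln x \<le> 11 / 12 * x - 3 * ln x - 31"
    by real_asymp
  then obtain X where X: "\<And>x. x \<ge> X \<Longrightarrow>
      183 / 200 * x + sqrt x * log 2 x * ln x \<le> 11 / 12 * x - 3 * ln x - 31"
    unfolding eventually_at_top_linorder by blast
  \<comment> \<open>The final inequality at $n = 1.1 \log m$, with $y = m$. The constant $457/500 = 0.914$ is what
      remains of $0.915$ after replacing $\log n$ by $n/1000 + \log 1000$; the inequality holds
      eventually because $1.1 \cdot 0.914 > 1$.\<close>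
  have "\<forall>\<^sub>F y::real in at_top.
      y * (ln y + ln 1000) \<le> 11 / 10 * ln y * (457 / 500 * y - 4)"
    by real_asymp
  then obtain Y :: real where Y: "\<And>y. y \<ge> Y \<Longrightarrow>
      y * (ln y + ln 1000) \<le> 11 / 10 * ln y * (457 / 500 * y - 4)"
    unfolding eventually_at_top_linorder by blast
  define M where "M = nat \<lceil>max 30 (max X Y)\<rceil>"
  have main: "int (prime_pi (real (m * n))) - int (prime_pi (real n)) \<ge> int m - 1"
    if n: "n \<ge> 1" and m: "m \<ge> M" and nm: "int n \<ge> \<lceil>1.1 * ln (2.5 * real m)\<rceil>"
    for m n :: nat
  proof -
    define D where "D = real (prime_pi (real (m * n))) - real (prime_pi (real n))"
    have m': "real m \<ge> 30" "real m \<ge> X" "real m \<ge> Y" using m unfolding M_def by linarith+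
    have "real n \<ge> 11 / 10 * ln (5 / 2 * real m)" using nm by (simp add: ceiling_le_iff)
    moreover have "ln (real m) \<le> ln (5 / 2 * real m)" using m' by simp
    ultimately have nm': "real n \<ge> 11 / 10 * ln (real m)" by linarith
    define x where "x = m * n"
    have "m * 1 \<le> x" "1 * n \<le> x" unfolding x_def using n m' by (intro mult_mono; simp)+
    hence x: "m \<le> x" "n \<le> x" by simp_all
    hence x': "real x \<ge> 30" "real x \<ge> X" using m' by linarith+
    have lnx: "ln x = ln m + ln n" using n m' unfolding x_def by (simp add: ln_mult)
    have "11 / 12 * real x - 3 * ln x - 31 \<le> psi x" using x' by (intro psi_lower) simp
    moreover have "psi x - psi n \<le> (D + sqrt x * log 2 x) * ln x"
      unfolding D_def x_def[symmetric] using x x' by (intro psi_diff_le_prime_pi_diff) auto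
    ultimately have "183 / 200 * real x - 4 * real n \<le> D * ln x"
      using X[OF x'(2)] psi_upper[of n] by (simp add: algebra_simps)
    moreover have "real m * ln x \<le> 183 / 200 * real x - 4 * real n"
    proof -
      \<comment> \<open>Bounding $\log n$ linearly makes the claim linear in $n$, so that all large $n$ are
          treated together with the least admissible one.\<close>
      have "ln (real n / 1000) \<le> real n / 1000 - 1" using n by (intro ln_le_minus_one) simp
      hence ln_n: "ln (real n) \<le> real n / 1000 + ln 1000" using n by (simp add: ln_div)
      have "real m * ln x \<le> real m * (ln m + (real n / 1000 + ln 1000))"
        unfolding lnx using ln_n by (intro mult_left_mono) auto
      also have "\<dots> = real m * (ln m + ln 1000) + real n * real m / 1000" by (simp add: algebra_simps)
      also have "real m * (ln m + ln 1000) \<le> 11 / 10 * ln m * (457 / 500 * real m - 4)"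
        using m' by (intro Y)
      also have "\<dots> \<le> real n * (457 / 500 * real m - 4)"
        using nm' m' by (intro mult_right_mono) auto
      finally show ?thesis unfolding x_def by (simp add: algebra_simps)
    qed
    ultimately have "real m * ln x \<le> D * ln x" by linarith
    moreover have "ln x > 0" using x' by (intro ln_gt_zero) auto
    ultimately have "real m \<le> D" by simp
    thus ?thesis unfolding D_def by linarith
  qed
  have "M \<ge> 1" unfolding M_def by linarith
  thus ?thesis using main by blast
qed

end
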